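(* Let $d\geq 3$ be an odd integer. There is no singular homogeneous polynomial $f\in\mathbb{C}[x_1,x_2]$ of degree $d$ such that $H(f)=\alpha(x_1x_2)^{d-2}$ for some $\alpha\in\mathbb{C}$, $\alpha\neq 0$.
   Context: For a homogeneous polynomial $f\in \mathbb{C}[x_1,x_2]$, $\mathrm{Hess}(f)=\left(\frac{\partial^2 f}{\partial x_i\partial x_j}\right)_{1\le i,j\le 2}$ is the Hessian matrix and $H(f)=\det(\mathrm{Hess}(f))$. A homogeneous polynomial $f$ of degree $d$ in $x_1,x_2$ is singular if its first partial derivatives $\partial f/\partial x_1,\partial f/\partial x_2$ have a common zero in $\mathbb{P}^1_{\mathbb{C}}$ (equivalently, $f$ has a repeated linear factor or is zero). *)

theory Defs
  imports "HOL-Analysis.Determinants" "HOL-Computational_Algebra.Polynomial"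
begin

text \<open>
  The ring of complex polynomials in two variables is represented by the type
  \<^typ>\<open>complex poly poly\<close>: the inner variable is \<open>x\<^sub>1\<close>, the outer one is \<open>x\<^sub>2\<close>, so the
  coefficient of \<open>x\<^sub>1\<^sup>i x\<^sub>2\<^sup>j\<close> in \<open>f\<close> is \<open>coeff (coeff f j) i\<close>.
\<close>

definition X1 :: "complex poly poly" where
  "X1 = [:[:0, 1:]:]"

definition X2 :: "complex poly poly" where
  "X2 = [:0, 1:]"

definition eval2 :: "complex poly poly \<Rightarrow> complex ^ 2 \<Rightarrow> complex" where
  "eval2 f p = poly (poly f [:p $ 2:]) (p $ 1)"

text \<open>The zero polynomial is homogeneous of every degree.\<close>

definition homogeneous :: "nat \<Rightarrow> complex poly poly \<Rightarrow> bool" where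
  "homogeneous d f \<longleftrightarrow> (\<forall>i j. coeff (coeff f j) i \<noteq> 0 \<longrightarrow> i + j = d)"

definition partial :: "2 \<Rightarrow> complex poly poly \<Rightarrow> complex poly poly" where
  "partial i f = (if i = 1 then map_poly pderiv f else pderiv f)"

definition Hess :: "complex poly poly \<Rightarrow> complex poly poly ^ 2 ^ 2" where
  "Hess f = (\<chi> i j. partial i (partial j f))"

definition hessian_det :: "complex poly poly \<Rightarrow> complex poly poly" where
  "hessian_det f = det (Hess f)"

text \<open>
  Points of the complex projective line are given by nonzero vectors of homogeneous
  coordinates; for homogeneous \<open>f\<close>, vanishing of the partial derivatives does not depend
  on the chosen representative.
\<close>

definition singular :: "complex poly poly \<Rightarrow> bool" where
  "singular f \<longleftrightarrow> (\<exists>p :: complex ^ 2. p \<noteq> 0 \<and> (\<forall>i. eval2 (partial i f) p = 0))"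

end

theory Submission
  imports Defs
begin

text \<open>
  A binary form \<open>f\<close> of degree \<open>d\<close> in which a linear form \<open>l\<close> occurs with exact multiplicity \<open>m\<close>,
  where \<open>1 \<le> m < d\<close>, has a Hessian determinant in which \<open>l\<close> occurs with the exact
  \<^emph>\<open>even\<close> multiplicity \<open>2 m - 2\<close>; and if \<open>m = d\<close>, so that \<open>f\<close> is a multiple of \<open>l\<^sup>d\<close>, the
  Hessian determinant vanishes. If \<open>f\<close> is singular, it has a factor \<open>l\<close> with \<open>m \<ge> 2\<close>, and then
  \<open>l\<close> divides \<open>H(f) = \<alpha> (x\<^sub>1 x\<^sub>2)\<^bsup>d-2\<^esup>\<close>, so \<open>l\<close> is a multiple of \<open>x\<^sub>1\<close> or of \<open>x\<^sub>2\<close>.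
  Its multiplicity in \<open>H(f)\<close> is thus the odd number \<open>d - 2\<close>, which is a contradiction.

  Multiplicities are computed in one variable. Let \<open>p\<close> be the restriction of \<open>f\<close> to the chart
  \<open>x\<^sub>2 = 1\<close>. Euler's identity, applied to \<open>f\<close> and to both of its partial derivatives, expresses the
  derivatives in the direction of \<open>x\<^sub>2\<close> by those in the direction of \<open>x\<^sub>1\<close>, and \<open>H(f)\<close> restricts to
  \<open>(d - 1) (d p p'' - (d - 1) p'\<^sup>2)\<close> (lemma \<open>dehomogenized_hessian\<close>). If \<open>p = x\<^sup>m q\<close> with
  \<open>q(0) \<noteq> 0\<close>, the lowest coefficient of this polynomial is that of \<open>x\<^bsup>2m-2\<^esup>\<close>, namely
  \<open>(d - 1) m (m - d) q(0)\<^sup>2\<close>, which is what \<open>hessian_ne_monomial\<close> rests on. The chart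
  \<open>x\<^sub>1 = 1\<close> serves the one point of the projective line at which \<open>x\<^sub>2 = 0\<close>.
\<close>

section \<open>Calculus of binary forms\<close>

lemma coeff_partial_1: "coeff (coeff (partial 1 f) j) i = of_nat (Suc i) * coeff (coeff f j) (Suc i)"
  by (simp add: partial_def coeff_map_poly coeff_pderiv)

lemma coeff_partial_2: "coeff (coeff (partial 2 f) j) i = of_nat (Suc j) * coeff (coeff f (Suc j)) i"
  by (simp add: partial_def coeff_pderiv of_nat_poly)

lemma homogeneous_partial:
  assumes "homogeneous (Suc n) f"
  shows "homogeneous n (partial k f)"
proof -
  have "k = 1 \<or> k = 2"
    using exhaust_2 by blast
  then show ?thesis
    using assms unfolding homogeneous_def
    by (fastforce simp del: of_nat_Suc simp: coeff_partial_1 coeff_partial_2)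
qed

lemma coeff_X1_mult: "coeff (coeff (X1 * f) j) i = (case i of 0 \<Rightarrow> 0 | Suc k \<Rightarrow> coeff (coeff f j) k)"
  by (simp add: X1_def coeff_pCons split: nat.splits)

lemma coeff_X2_mult: "coeff (coeff (X2 * f) j) i = (case j of 0 \<Rightarrow> 0 | Suc k \<Rightarrow> coeff (coeff f k) i)"
  by (simp add: X2_def coeff_pCons split: nat.splits)

lemma Euler_identity:
  assumes "homogeneous d f"
  shows "X1 * partial 1 f + X2 * partial 2 f = of_nat d * f"
proof (intro poly_eqI)
  fix j i
  have "(of_nat i + of_nat j) * coeff (coeff f j) i = of_nat d * coeff (coeff f j) i"
    using assms unfolding homogeneous_def by (metis mult_zero_right of_nat_add)
  then show "coeff (coeff (X1 * partial 1 f + X2 * partial 2 f) j) i = coeff (coeff (of_nat d * f) j) i"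
    by (cases i; cases j)
       (simp_all del: of_nat_Suc add: coeff_X1_mult coeff_X2_mult coeff_partial_1 coeff_partial_2
          of_nat_poly distrib_right)
qed

lemma hessian_det_eq:
  "hessian_det f = partial 1 (partial 1 f) * partial 2 (partial 2 f)
                 - partial 1 (partial 2 f) * partial 2 (partial 1 f)"
  by (simp add: hessian_det_def Hess_def det_2)

text \<open>
  Scaling moves a singular point to the representative with a coordinate equal to \<open>1\<close>, where it can be
  seen in a chart.
\<close>

lemma homogeneous_scale:
  assumes "homogeneous d f"
  shows "poly (poly f [:c * y:]) (c * x) = c ^ d * poly (poly f [:y:]) x"
proof -
  have expand: "poly (poly f [:v:]) u =
      (\<Sum>j\<le>degree f. \<Sum>i\<le>degree (coeff f j). coeff (coeff f j) i * u ^ i * v ^ j)" for u v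
  proof -
    have "poly (poly f [:v:]) u = (\<Sum>j\<le>degree f. poly (coeff f j) u * v ^ j)"
      by (simp add: poly_altdef[of f] poly_sum poly_const_pow mult_ac)
    then show ?thesis
      by (simp add: poly_altdef sum_distrib_right)
  qed
  have scaled: "coeff (coeff f j) i * (c * x) ^ i * (c * y) ^ j
      = c ^ d * (coeff (coeff f j) i * x ^ i * y ^ j)" for i j
  proof (cases "coeff (coeff f j) i = 0")
    case False
    then have "d = i + j"
      using assms by (auto simp: homogeneous_def)
    then show ?thesis
      by (simp add: power_mult_distrib power_add)
  qed simp
  show ?thesis
    by (simp add: expand scaled sum_distrib_left)
qed

section \<open>The two affine charts\<close>

text \<open>
  \<open>chart2\<close> is the substitution \<open>x\<^sub>2 = 1\<close> and \<open>chart1\<close> is the substitution \<open>x\<^sub>1 = 1\<close>. They look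
  different because \<open>x\<^sub>2\<close> is the outer variable and \<open>x\<^sub>1\<close> the inner one. Each is a ring homomorphism
  that commutes with differentiation in the direction of the surviving variable.
\<close>

definition chart2 :: "complex poly poly \<Rightarrow> complex poly" where
  "chart2 f = poly f 1"

definition chart1 :: "complex poly poly \<Rightarrow> complex poly" where
  "chart1 f = map_poly (\<lambda>c. poly c 1) f"

lemma chart2_ring_hom:
  "chart2 (f + g) = chart2 f + chart2 g" "chart2 (f - g) = chart2 f - chart2 g"
  "chart2 (f * g) = chart2 f * chart2 g" "chart2 (f ^ n) = chart2 f ^ n"
  "chart2 (of_nat n) = of_nat n" "chart2 (smult [:a:] f) = smult a (chart2 f)"
  "chart2 X1 = [:0, 1:]" "chart2 X2 = 1"
  by (simp_all add: chart2_def X1_def X2_def)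

lemma coeff_chart1: "coeff (chart1 f) j = poly (coeff f j) 1"
  by (simp add: chart1_def coeff_map_poly)

lemma chart1_mult: "chart1 (f * g) = chart1 f * chart1 g"
  by (rule poly_eqI) (simp add: coeff_chart1 coeff_mult poly_sum)

lemma chart1_ring_hom:
  "chart1 (f + g) = chart1 f + chart1 g" "chart1 (f - g) = chart1 f - chart1 g"
  "chart1 (f * g) = chart1 f * chart1 g" "chart1 (f ^ n) = chart1 f ^ n"
  "chart1 (of_nat n) = of_nat n" "chart1 (smult [:a:] f) = smult a (chart1 f)"
  "chart1 X1 = 1" "chart1 X2 = [:0, 1:]"
proof -
  have one: "chart1 1 = 1"
    by (rule poly_eqI) (simp add: coeff_chart1)
  show "chart1 (f ^ n) = chart1 f ^ n"
    by (induction n) (simp_all add: one chart1_mult)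
  show "chart1 X1 = 1" "chart1 X2 = [:0, 1:]"
    by (rule poly_eqI; simp add: coeff_chart1 X1_def X2_def coeff_pCons split: nat.splits)+
  show "chart1 (of_nat n) = of_nat n"
    by (rule poly_eqI) (simp add: coeff_chart1 of_nat_poly coeff_pCons split: nat.splits)
qed (rule poly_eqI, simp add: coeff_chart1 chart1_mult)+

lemma chart2_partial_1: "chart2 (partial 1 f) = pderiv (chart2 f)"
proof -
  have "poly (map_poly pderiv f) 1 = pderiv (poly f 1)"
    by (induction f) (simp_all add: map_poly_pCons pderiv_add)
  then show ?thesis
    by (simp add: chart2_def partial_def)
qed

lemma chart1_partial_2: "chart1 (partial 2 f) = pderiv (chart1 f)"
  by (rule poly_eqI) (simp add: coeff_chart1 coeff_pderiv partial_def)

lemma degree_chart2_le: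
  assumes "homogeneous d f"
  shows "degree (chart2 f) \<le> d"
proof -
  have "degree (coeff f j) \<le> d" for j
    using assms by (intro degree_le) (auto simp: homogeneous_def)
  then show ?thesis
    by (simp add: chart2_def poly_altdef degree_sum_le)
qed

lemma degree_chart1_le:
  assumes "homogeneous d f"
  shows "degree (chart1 f) \<le> d"
proof (intro degree_le allI impI)
  fix j assume "d < j"
  then have "coeff f j = 0"
    using assms by (intro poly_eqI) (force simp: homogeneous_def)
  then show "coeff (chart1 f) j = 0"
    by (simp add: coeff_chart1)
qed

lemma eval2_chart2:
  assumes "homogeneous d f" "p $ 2 \<noteq> 0"
  shows "eval2 f p = (p $ 2) ^ d * poly (chart2 f) (p $ 1 / p $ 2)"
  using homogeneous_scale[OF assms(1), of "p $ 2" 1 "p $ 1 / p $ 2"] assms(2)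
  by (simp add: eval2_def chart2_def flip: one_pCons)

lemma eval2_chart1:
  assumes "homogeneous d f" "p $ 2 = 0"
  shows "eval2 f p = (p $ 1) ^ d * poly (chart1 f) 0"
  using homogeneous_scale[OF assms(1), of "p $ 1" 0 1] assms(2)
  by (simp add: eval2_def poly_0_coeff_0 coeff_chart1)

section \<open>Dehomogenized Hessians\<close>

text \<open>
  The Hessian of a form of degree \<open>n + 1\<close>, seen in a chart with coordinate \<open>x\<close>. Here \<open>p\<close> is the
  restricted form and \<open>p2\<close> is the restriction of its derivative in the other direction; \<open>h12\<close> and \<open>h22\<close>
  restrict the derivatives, in the other direction, of the two first partials. The hypotheses are the
  restrictions of the Euler identities, and they can be solved for \<open>p2\<close>, \<open>h12\<close> and \<open>h22\<close>. This
  abstract form serves both charts.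
\<close>

lemma dehomogenized_hessian:
  fixes p p2 h12 h22 :: "complex poly"
  defines "x \<equiv> [:0, 1:]"
  assumes e: "x * pderiv p + p2 = of_nat (Suc n) * p"
    and e1: "x * pderiv (pderiv p) + h12 = of_nat n * pderiv p"
    and e2: "x * pderiv p2 + h22 = of_nat n * p2"
  shows "pderiv (pderiv p) * h22 - pderiv p2 * h12
       = of_nat n * (of_nat (Suc n) * p * pderiv (pderiv p) - of_nat n * (pderiv p)\<^sup>2)"
proof -
  have p2: "p2 = of_nat (Suc n) * p - x * pderiv p"
    and h12: "h12 = of_nat n * pderiv p - x * pderiv (pderiv p)"
    and h22: "h22 = of_nat n * p2 - x * pderiv p2"
    using e e1 e2 by (simp_all add: algebra_simps)
  have dp2: "pderiv p2 = of_nat n * pderiv p - x * pderiv (pderiv p)"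
    unfolding p2 x_def by (simp add: pderiv_diff pderiv_mult pderiv_add pderiv_pCons algebra_simps)
  then show ?thesis
    unfolding h12 h22 dp2 unfolding p2 by (simp add: algebra_simps power2_eq_square)
qed

lemma pderiv_X: "pderiv [:0, 1:] = (1 :: complex poly)"
  by (simp add: pderiv_pCons)

lemma X_mult_pderiv_X_power:
  "[:0, 1:] * pderiv ([:0, 1:] ^ k) = of_nat k * ([:0, 1:] ^ k :: complex poly)"
proof (cases k)
  case (Suc m)
  show ?thesis
    unfolding Suc pderiv_power_Suc pderiv_X
    by (simp add: of_nat_poly algebra_simps)
qed simp

lemma power_X_mult_eq_imp:
  fixes B :: "complex poly"
  assumes eq: "[:0, 1:] ^ k * B = smult \<alpha> ([:0, 1:] ^ l)" and "\<alpha> \<noteq> 0" "poly B 0 \<noteq> 0"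
  shows "k = l"
proof -
  have ord: "order 0 ([:0, 1:] ^ m :: complex poly) = m" for m
    using order_power_n_n[of 0 m] by simp
  have "order 0 ([:0, 1:] ^ k * B) = k"
    using assms ord by (subst order_mult) (auto simp: order_0I)
  moreover have "order 0 (smult \<alpha> ([:0, 1:] ^ l)) = l"
    using assms ord by (simp add: order_smult)
  ultimately show ?thesis
    using eq by simp
qed

text \<open>
  A double root \<open>t\<close> of \<open>p\<close> is a root of its Hessian. If that were a monomial of odd degree
  \<open>n - 1\<close>, then \<open>t\<close> would be \<open>0\<close>; but at the root \<open>0\<close> the Hessian either vanishes identically or
  has even order. The degree bound makes \<open>x\<^bsup>n+1\<^esup>\<close>, up to a constant, the only
  nonzero \<open>p\<close> with \<open>p(0) = 0\<close> whose expected lowest Hessian coefficient cancels.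
\<close>

lemma hessian_ne_monomial:
  fixes p :: "complex poly"
  assumes n: "n \<ge> 1" and even: "even n" and deg: "degree p \<le> Suc n" and "\<alpha> \<noteq> 0"
    and root: "poly p t = 0" "poly (pderiv p) t = 0"
  shows "of_nat n * (of_nat (Suc n) * p * pderiv (pderiv p) - of_nat n * (pderiv p)\<^sup>2)
       \<noteq> smult \<alpha> ([:0, 1:] ^ (n - 1))"
proof
  let ?x = "[:0, 1:] :: complex poly"
  assume eq: "of_nat n * (of_nat (Suc n) * p * pderiv (pderiv p) - of_nat n * (pderiv p)\<^sup>2)
       = smult \<alpha> (?x ^ (n - 1))"
  have "poly (smult \<alpha> (?x ^ (n - 1))) t = 0"
    unfolding eq[symmetric] using root by simp
  then have "t = 0"
    using \<open>\<alpha> \<noteq> 0\<close> by simp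
  have "p \<noteq> 0"
    using eq \<open>\<alpha> \<noteq> 0\<close> by auto
  then obtain q where p0: "p = ?x ^ order 0 p * q" and "\<not> ?x dvd q"
    using order_decomp[of p 0] by auto
  then have q0: "poly q 0 \<noteq> 0"
    by (simp add: poly_eq_0_iff_dvd)
  have "order 0 p \<noteq> 0"
    using root \<open>t = 0\<close> \<open>p \<noteq> 0\<close> by (simp add: order_root)
  then obtain k where p: "p = ?x ^ Suc k * q"
    using p0 by (metis not0_implies_Suc)
  \<comment> \<open>Pull all powers of the variable out of the Hessian: \<open>p' = x\<^sup>k r\<close>. The second derivative is only
      handled through \<open>x p''\<close>, so that no exponent \<open>k - 1\<close> occurs and \<open>k = 0\<close> needs no separate case.\<close>
  define r where "r = of_nat (Suc k) * q + ?x * pderiv q"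
  define B where "B = of_nat n * (of_nat (Suc n) * q * (of_nat k * r + ?x * pderiv r) - of_nat n * r\<^sup>2)"
  have p': "pderiv p = ?x ^ k * r"
    unfolding p r_def
    using X_mult_pderiv_X_power[of k]
    by (simp add: pderiv_mult pderiv_X algebra_simps del: mult_pCons_left mult_pCons_right)
  have p'': "?x * pderiv (pderiv p) = ?x ^ k * (of_nat k * r + ?x * pderiv r)"
  proof -
    have "?x * pderiv (pderiv p) = ?x * pderiv (?x ^ k) * r + ?x ^ k * (?x * pderiv r)"
      unfolding p' by (simp add: pderiv_mult algebra_simps del: mult_pCons_left mult_pCons_right)
    then show ?thesis
      unfolding X_mult_pderiv_X_power
      by (simp add: algebra_simps del: mult_pCons_left mult_pCons_right)
  qed
  have "p * pderiv (pderiv p) = ?x ^ k * q * (?x * pderiv (pderiv p))"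
    by (subst p) (simp add: mult_ac del: mult_pCons_left mult_pCons_right)
  also have "\<dots> = ?x ^ (2 * k) * (q * (of_nat k * r + ?x * pderiv r))"
    unfolding p'' mult_2 power_add by (simp add: mult_ac del: mult_pCons_left mult_pCons_right)
  finally have pp'': "p * pderiv (pderiv p) = \<dots>" .
  have sq: "(pderiv p)\<^sup>2 = ?x ^ (2 * k) * r\<^sup>2"
    unfolding p' by (simp add: power_mult_distrib power_mult mult.commute flip: power_mult)
  have B: "?x ^ (2 * k) * B = smult \<alpha> (?x ^ (n - 1))"
    unfolding eq[symmetric] B_def mult.assoc[of _ p] pp'' sq
    by (simp add: algebra_simps del: mult_pCons_left mult_pCons_right)
  have degp: "degree p = Suc k + degree q"
    using q0 unfolding p by (subst degree_mult_eq) (auto simp: degree_power_eq simp del: power_Suc)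
  \<comment> \<open>The case \<open>k = n\<close> is that of a pure power of a linear form.\<close>
  show False
  proof (cases "k = n")
    case True
    then have "degree q = 0"
      using deg degp by simp
    then obtain c where "q = [:c:]"
      by (metis degree_eq_zeroE)
    then have "B = 0"
      unfolding B_def r_def True by (simp add: of_nat_poly power2_eq_square algebra_simps)
    then show False
      using B \<open>\<alpha> \<noteq> 0\<close> by simp
  next
    case False
    have "poly B 0 = of_nat n * of_nat (Suc k) * (poly q 0)\<^sup>2 * (of_nat k - of_nat n)"
      unfolding B_def r_def by (simp add: power2_eq_square algebra_simps)
    then have "poly B 0 \<noteq> 0"
      using False q0 n by (simp del: of_nat_Suc)
    then have "2 * k = n - 1"
      using power_X_mult_eq_imp B \<open>\<alpha> \<noteq> 0\<close> by blast
    then show False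
      using n even by presburger
  qed
qed

text \<open>
  Vanishing of the two first partials at \<open>t\<close> makes \<open>t\<close> a double root of \<open>p\<close>, by Euler's identity.
\<close>

lemma hessian_chart_contradiction:
  fixes p p2 h12 h22 :: "complex poly"
  assumes n: "n \<ge> 1" "even n" and deg: "degree p \<le> Suc n" and \<alpha>: "\<alpha> \<noteq> 0"
    and e: "[:0, 1:] * pderiv p + p2 = of_nat (Suc n) * p"
    and e1: "[:0, 1:] * pderiv (pderiv p) + h12 = of_nat n * pderiv p"
    and e2: "[:0, 1:] * pderiv p2 + h22 = of_nat n * p2"
    and H: "pderiv (pderiv p) * h22 - pderiv p2 * h12 = smult \<alpha> ([:0, 1:] ^ (n - 1))"
    and root: "poly (pderiv p) t = 0" "poly p2 t = 0"
  shows False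
proof -
  have "of_nat (Suc n) * poly p t = 0"
    using arg_cong[OF e, of "\<lambda>u. poly u t"] root by simp
  then have "poly p t = 0"
    by (simp del: of_nat_Suc)
  then show False
    using hessian_ne_monomial[OF n deg \<alpha> _ root(1)] dehomogenized_hessian[OF e e1 e2] H by simp
qed

theorem theorem2p8:
  fixes d :: nat
  assumes "d \<ge> 3" and "odd d"
  shows "\<not> (\<exists>f :: complex poly poly. homogeneous d f \<and> singular f \<and>
           (\<exists>\<alpha> :: complex. \<alpha> \<noteq> 0 \<and> hessian_det f = smult [:\<alpha>:] ((X1 * X2) ^ (d - 2))))"
proof safe
  fix f :: "complex poly poly" and \<alpha> :: complex
  assume hom: "homogeneous d f" and "singular f" and \<alpha>: "\<alpha> \<noteq> 0"
    and H: "hessian_det f = smult [:\<alpha>:] ((X1 * X2) ^ (d - 2))"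
  obtain n where d: "d = Suc n" and n: "n \<ge> 1" "even n"
    using assms by (cases d) auto
  have hom1: "homogeneous n (partial k f)" for k
    using hom homogeneous_partial d by simp
  note E = Euler_identity[OF hom, unfolded d]
  note E1 = Euler_identity[OF hom1[of 1]] and E2 = Euler_identity[OF hom1[of 2]]
  have H': "partial 1 (partial 1 f) * partial 2 (partial 2 f)
      - partial 1 (partial 2 f) * partial 2 (partial 1 f) = smult [:\<alpha>:] ((X1 * X2) ^ (n - 1))"
    using H d by (simp add: hessian_det_eq)
  obtain p :: "complex ^ 2" where "p \<noteq> 0" and p: "\<And>i. eval2 (partial i f) p = 0"
    using \<open>singular f\<close> by (auto simp: singular_def)
  show False
  proof (cases "p $ 2 = 0")
    case False
    have root: "poly (chart2 (partial i f)) (p $ 1 / p $ 2) = 0" for i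
      using p[of i] eval2_chart2[OF hom1 False] False by simp
    show False
      by (rule hessian_chart_contradiction[where ?p2.0 = "chart2 (partial 2 f)"
            and ?h12.0 = "chart2 (partial 2 (partial 1 f))"
            and ?h22.0 = "chart2 (partial 2 (partial 2 f))", OF n degree_chart2_le[OF hom, unfolded d] \<alpha>
            _ _ _ _ root[of 1, unfolded chart2_partial_1] root[of 2]])
         (use arg_cong[OF E, of chart2] arg_cong[OF E1, of chart2] arg_cong[OF E2, of chart2]
            arg_cong[OF H', of chart2] in
           \<open>simp_all only: chart2_ring_hom chart2_partial_1 mult_1_left mult_1_right\<close>)
  next
    case True
    then have "p $ 1 \<noteq> 0"
      using \<open>p \<noteq> 0\<close> by (auto simp: vec_eq_iff forall_2)
    then have root: "poly (chart1 (partial i f)) 0 = 0" for i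
      using p[of i] eval2_chart1[OF hom1 True] by simp
    show False
      by (rule hessian_chart_contradiction[where ?p2.0 = "chart1 (partial 1 f)"
            and ?h12.0 = "chart1 (partial 1 (partial 2 f))"
            and ?h22.0 = "chart1 (partial 1 (partial 1 f))", OF n degree_chart1_le[OF hom, unfolded d] \<alpha>
            _ _ _ _ root[of 2, unfolded chart1_partial_2] root[of 1]])
         (use arg_cong[OF E, of chart1] arg_cong[OF E1, of chart1] arg_cong[OF E2, of chart1]
            arg_cong[OF H', of chart1] in
           \<open>simp_all only: chart1_ring_hom chart1_partial_2 mult_1_left mult_1_right add.commute mult.commute\<close>)
  qed
qed

end
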